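(* Let $d\ge 1$ and let $L^{\mathrm{ideal}}\in\mathbb{C}^{d^2\times d^2}$ be a diagonalisable Lindbladian, with $V$ an invertible matrix that diagonalises $L^{\mathrm{ideal}}$ (i.e. $L^{\mathrm{ideal}}=VDV^{-1}$ with $D$ diagonal). Let $E^*\in\mathbb{C}^{d^2\times d^2}$ be a diagonalisable matrix and suppose there exists a Lindbladian $L^*\in\mathbb{C}^{d^2\times d^2}$ such that $E^*=\exp(L^* )$ and $$\lVert L^*-L^{\mathrm{ideal}}\rVert<\frac{\pi-\rho(L^{\mathrm{ideal}})}{\kappa(V)},$$ where $\lVert\cdot\rVert$ is the Frobenius norm, $\rho(L^{\mathrm{ideal}})$ is the spectral radius of $L^{\mathrm{ideal}}$ and $\kappa(V)$ is the condition number of $V$. Then, given $E=E^*$ as input (with any maximum branch number $m_{\max}\ge 0$), the Convex Solve method outputs an $L\in\mathcal{L}\cap\log(E)$, i.e. its output $L$ is a Lindbladian with $e^{L}=E$.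
   Context: Let $e_1,\dots,e_d$ be the standard basis of $\mathbb{C}^d$, and write $|e_j,e_k\rangle\!\rangle=e_j\otimes e_k$ for the standard basis of $\mathbb{C}^d\otimes\mathbb{C}^d\cong\mathbb{C}^{d^2}$, with $\langle\!\langle e_j,e_k|$ the conjugate transpose. The $\Gamma$-involution on $d^2\times d^2$ matrices is the linear map determined by $$\bigl(|e_j,e_k\rangle\!\rangle\langle\!\langle e_l,e_m|\bigr)^\Gamma=|e_j,e_l\rangle\!\rangle\langle\!\langle e_k,e_m|.$$ Let $|\omega\rangle\!\rangle=\frac{1}{\sqrt d}\sum_{j=1}^d|e_j,e_j\rangle\!\rangle$ and $\omega_\perp=\mathbb{1}-|\omega\rangle\!\rangle\langle\!\langle\omega|$. A matrix $L\in\mathbb{C}^{d^2\times d^2}$ is called a Lindbladian if (1) $L^\Gamma$ is Hermitian, (2) $\omega_\perp L^\Gamma\omega_\perp\succeq 0$, and (3) $\langle\!\langle\omega|L=0$. The set of all Lindbladians is denoted $\mathcal{L}$; it is a closed convex cone. For a square matrix $E$, $\log(E)=\{A: e^A=E\}$. The spectral radius $\rho(A)$ is the maximum of $|\lambda|$ over eigenvalues $\lambda$ of $A$. The condition number of an invertible matrix $B$ is $\kappa(B)=\lVert B\rVert_{\mathrm{op}}\lVert B^{-1}\rVert_{\mathrm{op}}$ (spectral norm). Convex Solve method. Input: a diagonalisable $d^2\times d^2$ matrix $E$ and an integer $m_{\max}\ge 0$. 1. Compute some eigendecomposition $E=\sum_{j=1}^{d^2}\mu_j|r_j\rangle\!\rangle\langle\!\langle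 l_j|$ with right eigenvectors $|r_j\rangle\!\rangle$ and left eigenvectors $\langle\!\langle l_j|$ satisfying $\langle\!\langle l_i|r_j\rangle\!\rangle=\delta_{ij}$. 2. For each $j$, let $\lambda_j$ be a principal logarithm of $\mu_j$: $e^{\lambda_j}=\mu_j$ and $|\mathrm{Im}(\lambda_j)|\le\pi$ (unique unless $\mu_j$ is real negative). 3. For each $m\in\{-m_{\max},\dots,0,\dots,m_{\max}\}^{d^2}$, set $A_m=\sum_{j=1}^{d^2}(\lambda_j+2\pi i\,m_j)|r_j\rangle\!\rangle\langle\!\langle l_j|$, let $L_m$ be an (exact) minimiser of $\lVert L-A_m\rVert$ (Frobenius norm) over $L\in\mathcal{L}$, and let $\Delta_m=\lVert e^{L_m}-E\rVert$. 4. Output $L_{m_{\mathrm{opt}}}$, where $m_{\mathrm{opt}}$ minimises $\Delta_m$ over all $m$ considered. *)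

theory Defs
  imports "HOL-Analysis.Analysis"
begin

text \<open>
  The space \<open>\<complex>\<^sup>d\<close> is \<^typ>\<open>complex^'n\<close> with \<open>d = CARD('n)\<close>, and \<open>\<complex>\<^sup>d \<otimes> \<complex>\<^sup>d\<close> is
  \<^typ>\<open>complex^('n \<times> 'n)\<close>, where \<open>axis (j, k) 1\<close> is \<open>e\<^sub>j \<otimes> e\<^sub>k\<close>.  The library norm on
  matrices is the Frobenius norm, see \<open>norm_matrix_Frobenius\<close>.
\<close>

type_synonym 'n supermat = "complex^('n \<times> 'n)^('n \<times> 'n)"

lemma norm_matrix_Frobenius:
  "norm (A :: complex^'b^'a) = sqrt (\<Sum>i\<in>UNIV. \<Sum>j\<in>UNIV. (cmod (A $ i $ j))\<^sup>2)"
  by (simp add: norm_vec_def L2_set_def sum_nonneg)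


subsection \<open>Complex matrices\<close>

text \<open>The bra of a ket, as a row vector; the bra \<open>u\<close> applied to the ket \<open>v\<close> is \<open>braket u v\<close>.\<close>

definition bra :: "complex^'a \<Rightarrow> complex^'a" where
  "bra u = (\<chi> i. cnj (u $ i))"

definition braket :: "complex^'a \<Rightarrow> complex^'a \<Rightarrow> complex" where
  "braket u v = (\<Sum>i\<in>UNIV. cnj (u $ i) * v $ i)"

definition ketbra :: "complex^'a \<Rightarrow> complex^'b \<Rightarrow> complex^'b^'a" where
  "ketbra u v = (\<chi> i j. u $ i * cnj (v $ j))"

definition mscale :: "complex \<Rightarrow> complex^'b^'a \<Rightarrow> complex^'b^'a" where
  "mscale c A = (\<chi> i j. c * A $ i $ j)"

definition hermitian :: "complex^'a^'a \<Rightarrow> bool" where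
  "hermitian A \<longleftrightarrow> (\<forall>i j. A $ i $ j = cnj (A $ j $ i))"

definition psd :: "complex^'a^'a \<Rightarrow> bool" where
  "psd A \<longleftrightarrow> hermitian A \<and> (\<forall>v. 0 \<le> Re (braket v (A *v v)))"

definition diagonal :: "complex^'a^'a \<Rightarrow> bool" where
  "diagonal D \<longleftrightarrow> (\<forall>i j. i \<noteq> j \<longrightarrow> D $ i $ j = 0)"

definition diagonalises :: "complex^'a^'a \<Rightarrow> complex^'a^'a \<Rightarrow> bool" where
  "diagonalises V A \<longleftrightarrow> invertible V \<and> (\<exists>D. diagonal D \<and> A = V ** D ** matrix_inv V)"

definition diagonalisable :: "complex^'a^'a \<Rightarrow> bool" where
  "diagonalisable A \<longleftrightarrow> (\<exists>V. diagonalises V A)"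

definition eigenvalues :: "complex^'a^'a \<Rightarrow> complex set" where
  "eigenvalues A = {z. \<exists>v. v \<noteq> 0 \<and> A *v v = z *s v}"

definition spectral_radius :: "complex^'a^'a \<Rightarrow> real" where
  "spectral_radius A = Max (cmod ` eigenvalues A)"

definition condition_number :: "complex^'a^'a \<Rightarrow> real" where
  "condition_number B = onorm ((*v) B) * onorm ((*v) (matrix_inv B))"

text \<open>
  Multiplication and power in the library's algebra structure on \<^typ>\<open>complex^'a^'a\<close> are
  entrywise, so \<^const>\<open>exp\<close> is not available and powers are iterates of \<open>(**)\<close>.
\<close>

definition mexp :: "complex^'a^'a \<Rightarrow> complex^'a^'a" where
  "mexp A = (\<Sum>k. (1 / fact k) *\<^sub>R (((**) A) ^^ k) (mat 1))"

definition mlog :: "complex^'a^'a \<Rightarrow> (complex^'a^'a) set" where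
  "mlog E = {A. mexp A = E}"


subsection \<open>Lindbladians\<close>

definition Gamma_involution :: "'n::finite supermat \<Rightarrow> 'n supermat" where
  "Gamma_involution M = (\<chi> p q. M $ (fst p, fst q) $ (snd p, snd q))"

lemma Gamma_involution_basis:
  "Gamma_involution (ketbra (axis (j, k) 1) (axis (l, m) 1)) = ketbra (axis (j, l) 1) (axis (k, m) 1)"
  by (auto simp: Gamma_involution_def ketbra_def axis_def vec_eq_iff)

definition omega :: "complex^('n::finite \<times> 'n)" where
  "omega = (1 / sqrt (real CARD('n))) *\<^sub>R (\<Sum>j\<in>UNIV. axis (j, j) 1)"

definition omega_perp :: "'n::finite supermat" where
  "omega_perp = mat 1 - ketbra omega omega"

definition lindbladians :: "'n::finite supermat set" where
  "lindbladians = {L.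
     hermitian (Gamma_involution L) \<and>
     psd (omega_perp ** Gamma_involution L ** omega_perp) \<and>
     bra omega v* L = 0}"


subsection \<open>The Convex Solve method\<close>

text \<open>
  The left eigenvector \<open>l j\<close> is given as a ket; the corresponding bra is \<open>bra (l j)\<close>.
\<close>

definition eigendecomposition ::
    "complex^'a^'a \<Rightarrow> ('a \<Rightarrow> complex) \<Rightarrow> ('a \<Rightarrow> complex^'a) \<Rightarrow> ('a \<Rightarrow> complex^'a) \<Rightarrow> bool" where
  "eigendecomposition E \<mu> r l \<longleftrightarrow>
     (\<forall>j. E *v r j = \<mu> j *s r j) \<and>
     (\<forall>j. bra (l j) v* E = \<mu> j *s bra (l j)) \<and>
     (\<forall>i j. braket (l i) (r j) = (if i = j then 1 else 0)) \<and>
     E = (\<Sum>j\<in>UNIV. mscale (\<mu> j) (ketbra (r j) (l j)))"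

definition principal_log :: "complex \<Rightarrow> complex \<Rightarrow> bool" where
  "principal_log \<mu> z \<longleftrightarrow> exp z = \<mu> \<and> \<bar>Im z\<bar> \<le> pi"

definition branches :: "nat \<Rightarrow> ('a \<Rightarrow> int) set" where
  "branches mmax = {m. \<forall>j. m j \<in> {- int mmax..int mmax}}"

definition branch_log ::
    "('a \<Rightarrow> complex) \<Rightarrow> ('a \<Rightarrow> complex^'a) \<Rightarrow> ('a \<Rightarrow> complex^'a) \<Rightarrow> ('a \<Rightarrow> int)
      \<Rightarrow> complex^'a^'a" where
  "branch_log lam r l m =
     (\<Sum>j\<in>UNIV. mscale (lam j + 2 * pi * \<i> * of_int (m j)) (ketbra (r j) (l j)))"

text \<open>
  The method leaves several choices open (the eigendecomposition, the principal logarithm of a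
  negative eigenvalue, ties between minimisers), so it is rendered as a relation between inputs
  and possible outputs.
\<close>

definition convex_solve_output ::
    "'n::finite supermat \<Rightarrow> nat \<Rightarrow> 'n supermat \<Rightarrow> bool" where
  "convex_solve_output E mmax L \<longleftrightarrow>
     (\<exists>\<mu> r l lam Lm mopt.
        eigendecomposition E \<mu> r l \<and>
        (\<forall>j. principal_log (\<mu> j) (lam j)) \<and>
        (\<forall>m\<in>branches mmax.
           is_arg_min (\<lambda>X. norm (X - branch_log lam r l m)) (\<lambda>X. X \<in> lindbladians) (Lm m)) \<and>
        is_arg_min (\<lambda>m. norm (mexp (Lm m) - E)) (\<lambda>m. m \<in> branches mmax) mopt \<and>
        L = Lm mopt)"

end

(*
  By Bauer-Fike, all eigenvalues of L* have modulus < pi.  If E* r = mu r, then ker (E* - mu) is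
  invariant under L*; every eigenvalue a of L* on it satisfies e^a = mu, so a is the principal
  logarithm of mu, and L* has no Jordan block of size 2 there, since its exponential is not diagonal.
  Hence L* acts on ker (E* - mu) as the principal logarithm of mu, so A_0 = L* whichever
  eigendecomposition was computed.  The branch m = 0 therefore attains Delta_0 = 0.
*)
theory Submission
  imports Defs "HOL-Computational_Algebra.Fundamental_Theorem_Algebra"
begin

subsection \<open>Polynomials of a matrix applied to a vector\<close>

text \<open>This is p(A)u by Horner's scheme, so only matrix-vector products occur.\<close>

definition poly_apply :: "complex^'a^'a \<Rightarrow> complex poly \<Rightarrow> complex^'a \<Rightarrow> complex^'a" where
  "poly_apply A p u = fold_coeffs (\<lambda>a v. a *s u + A *v v) p 0"

lemma poly_apply_0 [simp]: "poly_apply A 0 u = 0"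
  by (simp add: poly_apply_def)

lemma poly_apply_pCons [simp]: "poly_apply A (pCons a p) u = a *s u + A *v poly_apply A p u"
  by (cases "p = 0 \<and> a = 0") (auto simp: poly_apply_def fold_coeffs_pCons_coeff_not_0_eq
      fold_coeffs_pCons_not_0_0_eq)

lemma poly_apply_add: "poly_apply A (p + q) u = poly_apply A p u + poly_apply A q u"
  by (induction p q rule: poly_induct2) (simp_all add: algebra_simps vec.scale_left_distrib)

lemma poly_apply_smult: "poly_apply A (smult c p) u = c *s poly_apply A p u"
  by (induction p) (simp_all add: vec.scale vec.scale_right_distrib)

lemma poly_apply_sum: "poly_apply A (\<Sum>i\<in>S. p i) u = (\<Sum>i\<in>S. poly_apply A (p i) u)"
  by (induction S rule: infinite_finite_induct) (simp_all add: poly_apply_add)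

lemma poly_apply_monom: "poly_apply A (monom c n) u = c *s (((*v) A) ^^ n) u"
  by (induction n) (simp_all add: monom_Suc monom_0 vec.scale)

text \<open>Polynomials in A commute, so a linear factor can act on the vector first. This lets a
  root of p be removed at the price of replacing u by (A - a)u.\<close>

lemma poly_apply_linear_factor:
  "poly_apply A ([:- a, 1:] * p) u = poly_apply A p (A *v u - a *s u)"
proof (induction p)
  case (pCons b p)
  have "[:- a, 1:] * pCons b p = smult b [:- a, 1:] + pCons 0 ([:- a, 1:] * p)"
    by simp
  then have "poly_apply A ([:- a, 1:] * pCons b p) u
      = b *s (A *v u - a *s u) + A *v poly_apply A ([:- a, 1:] * p) u"
    by (simp only: poly_apply_add poly_apply_smult) (simp add: algebra_simps)
  then show ?case
    using pCons.IH by simp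
qed simp

text \<open>In dimension d the d + 1 vectors u, Au, ..., A^d u are linearly dependent; the
  coefficients of a dependency are those of p.\<close>

lemma annihilating_poly_exists:
  fixes A :: "complex^'a^'a"
  obtains p where "p \<noteq> 0" "poly_apply A p u = 0"
\<comment> \<open>Dependence is a property of sets of vectors, so a coincidence of two iterates is
  treated on its own.\<close>
proof (cases "inj_on (\<lambda>i. (((*v) A) ^^ i) u) {..CARD('a)}")
  case False
  then obtain i j where ij: "i \<noteq> j" "(((*v) A) ^^ i) u = (((*v) A) ^^ j) u"
    by (auto simp: inj_on_def)
  let ?p = "monom 1 i + monom (-1) j :: complex poly"
  have "coeff ?p i \<noteq> 0"
    using ij(1) by simp
  then have "?p \<noteq> 0"
    by force
  moreover have "poly_apply A ?p u = 0"
    using ij(2) by (simp add: poly_apply_add poly_apply_monom)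
  ultimately show thesis
    using that by blast
next
  case True
  let ?f = "\<lambda>i. (((*v) A) ^^ i) u"
  let ?S = "?f ` {..CARD('a)}"
  have "card ?S = Suc CARD('a)"
    using card_image[OF True] by simp
  then have "vec.dependent ?S"
    using vec.dependent_biggerset_general[of ?S] dim_subset_UNIV_cart_gen[of ?S] by simp
  then obtain c where c: "\<exists>v\<in>?S. c v \<noteq> 0" "(\<Sum>v\<in>?S. c v *s v) = 0"
    using vec.dependent_finite[of ?S] by auto
  let ?p = "\<Sum>i\<le>CARD('a). monom (c (?f i)) i"
  obtain i where "i \<le> CARD('a)" "c (?f i) \<noteq> 0"
    using c(1) by auto
  then have "coeff ?p i \<noteq> 0"
    by (simp add: coeff_sum if_distrib sum.delta cong: if_cong)
  then have "?p \<noteq> 0"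
    by force
  moreover have "poly_apply A ?p u = 0"
    using c(2) by (simp add: poly_apply_sum poly_apply_monom sum.reindex[OF True])
  ultimately show thesis
    using that by blast
qed

text \<open>A polynomial annihilating u splits into linear factors over the complex numbers.
  Removing them one by one replaces u by (A - a)u, which stays in W, until a nonzero constant is
  left and the vector must be 0. Read backwards, this is an induction starting at 0; it takes the
  place of a triangularisation of A on W.\<close>

lemma invariant_subspace_induct:
  fixes A :: "complex^'a^'a"
  assumes "vec.subspace W" and inv: "\<And>w. w \<in> W \<Longrightarrow> A *v w \<in> W" and "u \<in> W"
    and zero: "P 0"
    and step: "\<And>w a. w \<in> W \<Longrightarrow> A *v w - a *s w \<in> W \<Longrightarrow> P (A *v w - a *s w) \<Longrightarrow> P w"
  shows "P u"
proof -
  have "P u" if "p \<noteq> 0" "poly_apply A p u = 0" "u \<in> W" for p u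
    using that
  proof (induction "degree p" arbitrary: p u rule: less_induct)
    case less
    show ?case
    proof (cases "degree p = 0")
      case True
      then obtain c where "p = [:c:]"
        by (metis degree_eq_zeroE)
      then show ?thesis
        using less.prems zero by simp
    next
      case False
      then obtain a where "poly p a = 0"
        by (metis fundamental_theorem_of_algebra constant_degree)
      then obtain q where q: "p = [:- a, 1:] * q"
        by (metis poly_eq_0_iff_dvd dvdE)
      then have "q \<noteq> 0"
        using less.prems by auto
      have W: "A *v u - a *s u \<in> W"
        using less.prems assms(1) inv by (simp add: vec.subspace_diff vec.subspace_scale)
      have "degree q < degree p"
        using q \<open>q \<noteq> 0\<close> by (simp add: degree_mult_eq del: mult_pCons_left)
      moreover have "poly_apply A q (A *v u - a *s u) = 0"
        using less.prems q by (simp only: poly_apply_linear_factor)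
      ultimately have "P (A *v u - a *s u)"
        using less.hyps \<open>q \<noteq> 0\<close> W by blast
      then show ?thesis
        using step less.prems W by blast
    qed
  qed
  then show ?thesis
    using annihilating_poly_exists[of A u] assms(3) by metis
qed

lemma eigenvector_in_invariant_subspace:
  fixes A :: "complex^'a^'a"
  assumes "vec.subspace W" and "\<And>w. w \<in> W \<Longrightarrow> A *v w \<in> W"
    and "u \<in> W" "u \<noteq> 0"
  obtains a v where "v \<in> W" "v \<noteq> 0" "A *v v = a *s v"
proof -
  \<comment> \<open>The claim is vacuous at 0. In the induction step, either (A - a)w = 0 and w is
    itself an eigenvector, or the induction hypothesis supplies one.\<close>
  have "u \<noteq> 0 \<longrightarrow> (\<exists>a v. v \<in> W \<and> v \<noteq> 0 \<and> A *v v = a *s v)"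
    using assms(1-3) by (rule invariant_subspace_induct) auto
  then show thesis
    using assms(4) that by blast
qed

text \<open>If z is the only possible eigenvalue of A on W (\<open>eig\<close>) and there is no
  Jordan block of size 2 (\<open>chain\<close>), then A is z times the identity there.\<close>

lemma scalar_on_invariant_subspace:
  fixes A :: "complex^'a^'a"
  assumes "vec.subspace W" and "\<And>w. w \<in> W \<Longrightarrow> A *v w \<in> W" and "u \<in> W"
    and eig: "\<And>a v. v \<in> W \<Longrightarrow> v \<noteq> 0 \<Longrightarrow> A *v v = a *s v \<Longrightarrow> a = z"
    and chain: "\<And>w v. w \<in> W \<Longrightarrow> v \<in> W \<Longrightarrow> A *v w = z *s w + v \<Longrightarrow> A *v v = z *s v \<Longrightarrow> v = 0"
  shows "A *v u = z *s u"
  using assms(1-3)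
proof (rule invariant_subspace_induct[where P = "\<lambda>w. A *v w = z *s w"])
  show "A *v 0 = z *s 0"
    by simp
next
  fix w a
  assume w: "w \<in> W" and aw: "A *v w - a *s w \<in> W"
    and eq: "A *v (A *v w - a *s w) = z *s (A *v w - a *s w)"
  show "A *v w = z *s w"
  proof (cases "a = z")
    case True
    then show ?thesis
      using chain[OF w aw] eq by simp
  next
    case False
    \<comment> \<open>The factors of (A - z)(A - a)w = 0 commute, so (A - z)w would be an
      eigenvector for a \<noteq> z unless it vanishes.\<close>
    have "A *v (A *v w - z *s w) = a *s (A *v w - z *s w)"
      using eq by (simp add: matrix_vector_mult_diff_distrib vec.scale
          vec.scale_right_diff_distrib algebra_simps)
    moreover have "A *v w - z *s w \<in> W"
      using assms(1,2) w by (simp add: vec.subspace_diff vec.subspace_scale)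
    ultimately show ?thesis
      using eig False by force
  qed
qed


subsection \<open>The matrix exponential\<close>

text \<open>The series is dominated by the real exponential series of \<open>?K\<close>, the
  operator norm of left multiplication by A.\<close>

lemma mexp_sums: "(\<lambda>k. (1 / fact k) *\<^sub>R (((**) A) ^^ k) (mat 1)) sums mexp (A :: complex^'a^'a)"
proof -
  let ?K = "onorm ((**) A :: complex^'a^'a \<Rightarrow> complex^'a^'a)"
  have bl: "bounded_linear ((**) A :: complex^'a^'a \<Rightarrow> complex^'a^'a)"
    by (auto simp flip: linear_conv_bounded_linear intro!: linearI
        simp: vec_eq_iff matrix_matrix_mult_def scaleR_sum_right distrib_left sum.distrib)
  have "norm ((((**) A) ^^ k) (mat 1)) \<le> ?K ^ k * norm (mat 1 :: complex^'a^'a)" for k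
  proof (induction k)
    case (Suc k)
    have "norm ((((**) A) ^^ Suc k) (mat 1)) \<le> ?K * norm ((((**) A) ^^ k) (mat 1))"
      using onorm[OF bl] by simp
    also have "\<dots> \<le> ?K * (?K ^ k * norm (mat 1 :: complex^'a^'a))"
      using Suc onorm_pos_le[OF bl] by (rule mult_left_mono)
    finally show ?case
      by simp
  qed simp
  then have "norm ((1 / fact k) *\<^sub>R (((**) A) ^^ k) (mat 1))
      \<le> inverse (fact k) * ?K ^ k * norm (mat 1 :: complex^'a^'a)" for k
    by (simp add: divide_simps)
  then have "summable (\<lambda>k. (1 / fact k) *\<^sub>R (((**) A) ^^ k) (mat 1))"
    by (intro summable_comparison_test'[OF summable_mult2[OF summable_exp]])
  then show ?thesis
    by (simp add: mexp_def summable_sums)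
qed

text \<open>Evaluation at v is continuous and linear in the matrix, so the series may be applied
  termwise. The later facts on \<open>mexp\<close> all rest on this vector form.\<close>

lemma mexp_vector_sums:
  "(\<lambda>k. (1 / fact k) *\<^sub>R (((*v) A) ^^ k) v) sums (mexp A *v (v :: complex^'a))"
proof -
  have "bounded_linear (\<lambda>X :: complex^'a^'a. X *v v)"
    by (auto simp flip: linear_conv_bounded_linear intro!: linearI
        simp: vec_eq_iff matrix_vector_mult_def scaleR_sum_right distrib_right sum.distrib)
  moreover have "(((**) A) ^^ k) (mat 1) *v v = (((*v) A) ^^ k) v" for k
    by (induction k) (simp_all flip: matrix_vector_mul_assoc)
  moreover have "(c *\<^sub>R X) *v v = c *\<^sub>R (X *v v)" for c and X :: "complex^'a^'a"
    by (simp add: vec_eq_iff matrix_vector_mult_def scaleR_sum_right)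
  ultimately show ?thesis
    using bounded_linear.sums[OF _ mexp_sums[of A], of "\<lambda>X. X *v v"] by simp
qed

lemma mexp_commute_vector: "mexp A *v (A *v v) = A *v (mexp A *v v)"
proof (rule sums_unique2)
  show "(\<lambda>k. A *v ((1 / fact k) *\<^sub>R (((*v) A) ^^ k) v)) sums (A *v (mexp A *v v))"
    by (intro bounded_linear.sums[OF matrix_vector_mul_bounded_linear] mexp_vector_sums)
  have "(\<lambda>k. (1 / fact k) *\<^sub>R (((*v) A) ^^ k) (A *v v))
      = (\<lambda>k. A *v ((1 / fact k) *\<^sub>R (((*v) A) ^^ k) v))"
    by (intro ext) (simp add: linear_simps funpow_swap1)
  then show "(\<lambda>k. A *v ((1 / fact k) *\<^sub>R (((*v) A) ^^ k) v)) sums (mexp A *v (A *v v))"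
    using mexp_vector_sums[of A "A *v v"] by simp
qed

lemma bounded_linear_vector_scale_left: "bounded_linear (\<lambda>c. c *s (v :: complex^'a))"
  by (auto simp flip: linear_conv_bounded_linear intro!: linearI
      simp: vec.scale_left_distrib vec_eq_iff)

lemma exp_vector_sums: "(\<lambda>k. (a ^ k /\<^sub>R fact k) *s v) sums (exp a *s (v :: complex^'a))"
  by (intro bounded_linear.sums[OF bounded_linear_vector_scale_left] exp_converges)

text \<open>The k-th iterate of A sends u to a^k u + k a^(k-1) v. The coefficients of v therefore
  form the termwise derivative of the exponential series at a, which sums to exp a again.\<close>

lemma mexp_Jordan_chain:
  fixes A :: "complex^'a^'a"
  assumes u: "A *v u = a *s u + v" and v: "A *v v = a *s v"
  shows "mexp A *v u = exp a *s u + exp a *s v"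
proof (rule sums_unique2[OF mexp_vector_sums])
  \<comment> \<open>At k = 0 the truncated exponent is harmless because of the factor k; the term is
    0, so the sum is unchanged by the index shift below.\<close>
  let ?g = "\<lambda>k. (of_nat k * a ^ (k - 1)) /\<^sub>R fact k :: complex"
  have "(((*v) A) ^^ k) u = a ^ k *s u + (of_nat k * a ^ (k - 1)) *s v" for k
  proof (induction k)
    case (Suc k)
    then show ?case
      by (cases k) (simp_all add: u v vec.add vec.scale, simp_all add: vec_eq_iff algebra_simps)
  qed simp
  then have "(1 / fact k) *\<^sub>R (((*v) A) ^^ k) u = (a ^ k /\<^sub>R fact k) *s u + ?g k *s v" for k
    by (simp add: vec_eq_iff field_simps)
  moreover have "?g (Suc k) = a ^ k /\<^sub>R fact k" for k
    by (simp add: scaleR_conv_of_real field_simps del: of_nat_Suc)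
  then have "(\<lambda>k. ?g (Suc k)) sums exp a"
    using exp_converges[of a] by simp
  then have "?g sums exp a"
    by (subst (asm) sums_Suc_iff) simp
  then have "(\<lambda>k. ?g k *s v) sums (exp a *s v)"
    by (rule bounded_linear.sums[OF bounded_linear_vector_scale_left])
  ultimately show "(\<lambda>k. (1 / fact k) *\<^sub>R (((*v) A) ^^ k) u) sums (exp a *s u + exp a *s v)"
    using sums_add[OF exp_vector_sums[of a u]] by simp
qed

lemma mexp_eigenvector: "A *v v = a *s v \<Longrightarrow> mexp A *v v = exp a *s (v :: complex^'a)"
  using mexp_Jordan_chain[of A v a 0] by simp

section \<open>Eigenspaces of the exponential as invariant subspaces of the matrix\<close>

lemma mexp_eigenspace_subspace: "vec.subspace {v. mexp A *v v = m *s v}"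
  by (auto simp: vec.subspace_def vec.add vec.scale vec.scale_right_distrib vec.zero)

lemma mexp_eigenspace_invariant: "mexp A *v v = m *s v \<Longrightarrow> mexp A *v (A *v v) = m *s (A *v v)"
  by (simp add: mexp_commute_vector vec.scale)

text \<open>The eigenspace for m is invariant under A, so it contains an eigenvector of A, for some
  a; then m = exp a.\<close>

lemma mexp_eigenvalue_nonzero:
  assumes "mexp A *v v = m *s v" "v \<noteq> 0"
  shows "m \<noteq> 0"
proof -
  obtain a w where "mexp A *v w = m *s w" "w \<noteq> 0" "A *v w = a *s w"
  proof (rule eigenvector_in_invariant_subspace[OF mexp_eigenspace_subspace[of A m], of A v])
  qed (use assms in \<open>auto simp: mexp_eigenspace_invariant\<close>)
  then show ?thesis
    using mexp_eigenvector[of A w a] by (auto simp: vec.scale_eq_0_iff)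
qed

text \<open>The imaginary parts differ by a multiple of 2 pi of modulus below 2 pi. One strict bound
  suffices, which matters because a principal logarithm may have imaginary part pi or -pi.\<close>

lemma exp_eq_imp_eq_of_Im_bounds:
  fixes w z :: complex
  assumes "exp w = exp z" "\<bar>Im w\<bar> < pi" "\<bar>Im z\<bar> \<le> pi"
  shows "w = z"
proof -
  obtain n :: int where n: "w = z + (of_int (2 * n) * pi) * \<i>"
    using assms(1) by (auto simp: exp_eq)
  then have "Im w - Im z = 2 * pi * of_int n"
    by simp
  then have "\<bar>2 * pi * of_int n\<bar> < 2 * pi"
    using assms(2,3) by linarith
  then have "n = 0"
    by (simp add: abs_mult)
  then show ?thesis
    using n by simp
qed

text \<open>On the eigenspace for m, an eigenvalue a of A satisfies exp a = m and \<bar>Im a\<bar> <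
  pi, hence a = z. A Jordan chain w, v for z would give exp(A)w = m w + m v, so m v = 0, and v = 0
  because m = exp z is nonzero.\<close>

lemma mexp_eigenvector_principal:
  fixes A :: "complex^'a^'a"
  assumes small: "\<And>a. a \<in> eigenvalues A \<Longrightarrow> cmod a < pi"
    and "principal_log m z" and "mexp A *v u = m *s u"
  shows "A *v u = z *s u"
proof (rule scalar_on_invariant_subspace[OF mexp_eigenspace_subspace[of A m]])
  have z: "exp z = m" "\<bar>Im z\<bar> \<le> pi"
    using assms(2) by (auto simp: principal_log_def)
  show "a = z" if "v \<in> {v. mexp A *v v = m *s v}" "v \<noteq> 0" "A *v v = a *s v" for a v
  proof (rule exp_eq_imp_eq_of_Im_bounds)
    show "exp a = exp z"
      using that mexp_eigenvector[of A v a] z by auto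
    show "\<bar>Im a\<bar> < pi"
      using small[of a] that abs_Im_le_cmod[of a] by (force simp: eigenvalues_def)
  qed (rule z)
  show "v = 0" if "w \<in> {v. mexp A *v v = m *s v}" "A *v w = z *s w + v" "A *v v = z *s v" for w v
    using that mexp_Jordan_chain[of A w z v] z by (auto simp: vec.scale_eq_0_iff)
qed (use assms in \<open>auto simp: mexp_eigenspace_invariant\<close>)


subsection \<open>Perturbation of eigenvalues\<close>

text \<open>Cauchy-Schwarz in each row. This links the Frobenius norm of the perturbation with the
  operator norms in the condition number.\<close>

lemma norm_matrix_vector_le: "norm (A *v x) \<le> norm A * norm (x :: complex^'a)"
proof -
  have "norm ((A *v x) $ i) \<le> norm x * norm (A $ i)" for i
  proof -
    have "norm ((A *v x) $ i) \<le> (\<Sum>j\<in>UNIV. \<bar>cmod (A $ i $ j)\<bar> * \<bar>cmod (x $ j)\<bar>)"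
      by (simp add: matrix_vector_mult_def norm_mult sum_norm_le)
    also have "\<dots> \<le> norm (A $ i) * norm x"
      unfolding norm_vec_def by (rule L2_set_mult_ineq)
    finally show ?thesis
      by (simp add: mult.commute)
  qed
  then have "norm (A *v x) \<le> L2_set (\<lambda>i. norm x * norm (A $ i)) UNIV"
    unfolding norm_vec_def[of "A *v x"] by (intro L2_set_mono) auto
  also have "\<dots> = norm A * norm x"
    by (simp add: norm_vec_def[of A] mult.commute L2_set_right_distrib)
  finally show ?thesis .
qed

lemma matrix_inv_inverse:
  assumes "invertible A"
  shows "A ** matrix_inv A = mat 1" "matrix_inv A ** A = mat 1"
  using someI_ex[OF assms[unfolded invertible_def]] by (simp_all add: matrix_inv_def)

lemma condition_number_pos:
  assumes "invertible (V :: complex^'a^'a)"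
  shows "0 < condition_number V"
proof -
  have 1: "onorm ((*v) B) > 0" if "B ** C = mat 1" for B C :: "complex^'a^'a"
  proof -
    have "B \<noteq> 0"
    proof
      assume "B = 0"
      then have "(mat 1 :: complex^'a^'a) = 0"
        using that by (simp add: matrix_matrix_mult_def vec_eq_iff)
      then show False
        by (simp add: mat_def vec_eq_iff) (metis one_neq_zero)
    qed
    then obtain x where "B *v x \<noteq> 0"
      by (metis matrix_eq matrix_vector_mult_0)
    then show ?thesis
      by (subst onorm_pos_lt) auto
  qed
  show ?thesis
    unfolding condition_number_def
    using 1[of V "matrix_inv V"] 1[of "matrix_inv V" V] matrix_inv_inverse[OF assms] by simp
qed

lemma diagonal_mult_vec: "diagonal D \<Longrightarrow> (D *v x) $ i = D $ i $ i * x $ i"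
  by (simp add: matrix_vector_mult_def diagonal_def sum.remove[of _ i])

text \<open>In the coordinates y = W v of an eigenvector v of B, the eigenvalue equation reads W(B -
  A)V y = (z - D)y. The right side has norm at least the smallest \<bar>z - D_ii\<bar> times the
  norm of y.\<close>

lemma Bauer_Fike:
  fixes A B V D :: "complex^'a^'a"
  assumes "invertible V" "diagonal D" "A = V ** D ** matrix_inv V" "z \<in> eigenvalues B"
  obtains i where "cmod (z - D $ i $ i) \<le> condition_number V * norm (B - A)"
proof -
  obtain v where v: "v \<noteq> 0" "B *v v = z *s v"
    using assms(4) by (auto simp: eigenvalues_def)
  define W where "W = matrix_inv V"
  have inv: "V ** W = mat 1" "W ** V = mat 1"
    using matrix_inv_inverse[OF assms(1)] by (simp_all add: W_def)
  define y where "y = W *v v"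
  have v_eq: "v = V *v y"
    by (simp add: y_def matrix_vector_mul_assoc inv)
  then have "y \<noteq> 0"
    using v by auto
  have "W *v (A *v v) = D *v y"
    by (simp add: assms(3) y_def matrix_vector_mul_assoc matrix_mul_assoc inv flip: W_def)
  then have eq: "W *v ((B - A) *v (V *v y)) = z *s y - D *v y"
    using v unfolding v_eq[symmetric]
    by (simp add: matrix_vector_mult_diff_rdistrib vec.diff vec.scale y_def)
  \<comment> \<open>The index of the diagonal entry closest to z.\<close>
  obtain i where i: "\<And>j. cmod (z - D $ i $ i) \<le> cmod (z - D $ j $ j)"
    using ex_min_if_finite[of "range (\<lambda>i. cmod (z - D $ i $ i))"] by (force simp: not_less)
  have "cmod (z - D $ i $ i) * norm y \<le> norm (z *s y - D *v y)"
    unfolding norm_vec_def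
    by (subst L2_set_right_distrib)
      (auto intro!: L2_set_mono mult_right_mono i
        simp: diagonal_mult_vec[OF assms(2)] left_diff_distrib[symmetric] norm_mult)
  also have "\<dots> \<le> onorm ((*v) W) * norm ((B - A) *v (V *v y))"
    unfolding eq[symmetric] by (rule onorm) simp
  also have "\<dots> \<le> onorm ((*v) W) * (norm (B - A) * (onorm ((*v) V) * norm y))"
    by (intro mult_left_mono order_trans[OF norm_matrix_vector_le] onorm onorm_pos_le) auto
  finally have "cmod (z - D $ i $ i) * norm y \<le> (condition_number V * norm (B - A)) * norm y"
    by (simp add: condition_number_def W_def mult_ac)
  then show thesis
    using that \<open>y \<noteq> 0\<close> by simp
qed

lemma eigenvalues_diagonalised:
  fixes A V D :: "complex^'a^'a"
  assumes "invertible V" "diagonal D" "A = V ** D ** matrix_inv V"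
  shows "eigenvalues A = range (\<lambda>i. D $ i $ i)"
proof (intro subset_antisym subsetI)
  fix z assume "z \<in> eigenvalues A"
  \<comment> \<open>The perturbation bound with B = A has right side 0, so z equals a diagonal
    entry.\<close>
  then obtain i where "cmod (z - D $ i $ i) \<le> condition_number V * norm (A - A)"
    using Bauer_Fike[OF assms] by blast
  then show "z \<in> range (\<lambda>i. D $ i $ i)"
    by auto
next
  fix z assume "z \<in> range (\<lambda>i. D $ i $ i)"
  then obtain i where z: "z = D $ i $ i"
    by auto
  let ?e = "axis i 1 :: complex^'a"
  have inv: "matrix_inv V ** V = mat 1"
    using matrix_inv_inverse[OF assms(1)] by simp
  have "D *v ?e = z *s ?e"
    using assms(2) by (auto simp: vec_eq_iff diagonal_mult_vec z axis_def)
  then have "A *v (V *v ?e) = z *s (V *v ?e)"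
    by (simp add: assms(3) inv vec.scale flip: matrix_vector_mul_assoc)
       (simp add: matrix_vector_mul_assoc inv vec.scale)
  moreover have "V *v ?e \<noteq> 0"
  proof
    assume "V *v ?e = 0"
    then have "matrix_inv V *v (V *v ?e) = 0"
      by simp
    then show False
      by (simp add: matrix_vector_mul_assoc inv)
  qed
  ultimately show "z \<in> eigenvalues A"
    by (auto simp: eigenvalues_def)
qed

text \<open>Some diagonal entry, of modulus at most the spectral radius of A, lies closer to z than
  r minus that radius; the triangle inequality finishes.\<close>

lemma eigenvalue_bound_near_diagonalisable:
  fixes A B V :: "complex^'a^'a"
  assumes "diagonalises V A" "norm (B - A) < (r - spectral_radius A) / condition_number V"
    and "z \<in> eigenvalues B"
  shows "cmod z < r"
proof -
  obtain D where D: "invertible V" "diagonal D" "A = V ** D ** matrix_inv V"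
    using assms(1) by (auto simp: diagonalises_def)
  obtain i where i: "cmod (z - D $ i $ i) \<le> condition_number V * norm (B - A)"
    using Bauer_Fike[OF D assms(3)] .
  have "cmod (D $ i $ i) \<le> spectral_radius A"
    unfolding spectral_radius_def eigenvalues_diagonalised[OF D] by (intro Max_ge) auto
  moreover have "condition_number V * norm (B - A) < r - spectral_radius A"
    using assms(2) condition_number_pos[OF D(1)] by (simp add: field_simps)
  ultimately show ?thesis
    using i norm_triangle_sub[of z "D $ i $ i"] by linarith
qed


subsection \<open>Eigendecompositions\<close>

lemma mult_ketbra: "A ** ketbra u v = ketbra (A *v u) v"
  by (simp add: vec_eq_iff matrix_matrix_mult_def matrix_vector_mult_def ketbra_def
      sum_distrib_right mult.assoc)

lemma ketbra_scale: "ketbra (c *s u) v = mscale c (ketbra u v)"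
  by (simp add: vec_eq_iff ketbra_def mscale_def mult.assoc)

lemma matrix_mult_sum_right: "A ** (\<Sum>j\<in>S. f j) = (\<Sum>j\<in>S. A ** f j)"
  for A :: "complex^'a^'b" and f :: "'i \<Rightarrow> complex^'c^'a"
  by (induction S rule: infinite_finite_induct) (simp_all add: matrix_add_ldistrib)

lemma eigendecomposition_right_eigenvector:
  "eigendecomposition E \<mu> r l \<Longrightarrow> E *v r j = \<mu> j *s r j"
  unfolding eigendecomposition_def by blast

lemma eigendecomposition_biorthonormal:
  "eigendecomposition E \<mu> r l \<Longrightarrow> braket (l i) (r j) = (if i = j then 1 else 0)"
  unfolding eigendecomposition_def by blast

text \<open>Biorthonormality says that the matrix of bras is a left inverse of the square matrix of
  kets, hence also a right inverse.\<close>

lemma eigendecomposition_completeness: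
  assumes "eigendecomposition E \<mu> r l"
  shows "(\<Sum>j\<in>UNIV. ketbra (r j) (l j)) = mat 1"
proof -
  let ?R = "\<chi> i j. r j $ i" and ?L = "\<chi> j i. cnj (l j $ i)"
  have "?L ** ?R = mat 1"
    using assms by (simp add: vec_eq_iff matrix_matrix_mult_def mat_def eigendecomposition_def braket_def)
  then have "?R ** ?L = mat 1"
    by (simp add: matrix_left_right_inverse)
  then show ?thesis
    by (simp add: vec_eq_iff matrix_matrix_mult_def ketbra_def)
qed

text \<open>Multiplying the resolution of the identity by A shows that A is determined by its action
  on the \<open>r j\<close>.\<close>

lemma branch_log_eq:
  assumes "eigendecomposition E \<mu> r l" and "\<And>j. A *v r j = lam j *s r j"
  shows "branch_log lam r l (\<lambda>_. 0) = A"
proof -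
  have "A = A ** (\<Sum>j\<in>UNIV. ketbra (r j) (l j))"
    using eigendecomposition_completeness[OF assms(1)] by simp
  also have "\<dots> = branch_log lam r l (\<lambda>_. 0)"
    by (simp add: branch_log_def matrix_mult_sum_right mult_ketbra assms(2) ketbra_scale)
  finally show ?thesis ..
qed

lemma eigendecomposition_exists:
  assumes "diagonalisable (E :: complex^'a^'a)"
  obtains \<mu> r l where "eigendecomposition E \<mu> r l"
proof -
  obtain V D :: "complex^'a^'a" where D: "invertible V" "diagonal D" "E = V ** D ** matrix_inv V"
    using assms by (auto simp: diagonalisable_def diagonalises_def)
  define W where "W = matrix_inv V"
  have inv: "V ** W = mat 1" "W ** V = mat 1"
    using matrix_inv_inverse[OF D(1)] by (simp_all add: W_def)
  define \<mu> where "\<mu> = (\<lambda>i. D $ i $ i)"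
  \<comment> \<open>Right eigenvectors are the columns of V, left ones the rows of its inverse; the
    latter are conjugated because \<open>l j\<close> is stored as a ket.\<close>
  define r where "r = (\<lambda>j. \<chi> i. V $ i $ j)"
  define l where "l = (\<lambda>j. \<chi> i. cnj (W $ j $ i))"
  have VD: "(V ** D) $ i $ j = \<mu> j * V $ i $ j" for i j
    using D(2) by (simp add: matrix_matrix_mult_def diagonal_def \<mu>_def sum.remove[of _ j])
  have DW: "(D ** W) $ i $ j = \<mu> i * W $ i $ j" for i j
    using D(2) by (simp add: matrix_matrix_mult_def diagonal_def \<mu>_def sum.remove[of _ i])
  have EV: "E ** V = V ** D"
    using D(3) by (simp add: inv flip: W_def matrix_mul_assoc)
  have WE: "W ** E = D ** W"
    using D(3) by (simp add: inv matrix_mul_assoc flip: W_def)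
  have "E *v r j = \<mu> j *s r j" for j
  proof -
    have "(E *v r j) $ i = (E ** V) $ i $ j" for i
      by (simp add: matrix_matrix_mult_def matrix_vector_mult_def r_def)
    then show ?thesis
      by (simp add: vec_eq_iff EV VD) (simp add: r_def)
  qed
  moreover have "bra (l j) v* E = \<mu> j *s bra (l j)" for j
  proof -
    have "(bra (l j) v* E) $ i = (W ** E) $ j $ i" for i
      by (simp add: matrix_matrix_mult_def vector_matrix_mult_def l_def bra_def mult.commute)
    then show ?thesis
      by (simp add: vec_eq_iff WE DW) (simp add: l_def bra_def)
  qed
  moreover have "braket (l i) (r j) = (if i = j then 1 else 0)" for i j
  proof -
    have "braket (l i) (r j) = (W ** V) $ i $ j"
      by (simp add: matrix_matrix_mult_def braket_def l_def r_def)
    then show ?thesis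
      by (simp add: inv mat_def)
  qed
  moreover have "E = (\<Sum>j\<in>UNIV. mscale (\<mu> j) (ketbra (r j) (l j)))"
  proof -
    have "E $ i $ k = (\<Sum>j\<in>UNIV. (V ** D) $ i $ j * W $ j $ k)" for i k
      by (simp add: D(3) W_def matrix_matrix_mult_def)
    then show ?thesis
      by (simp add: vec_eq_iff VD mscale_def ketbra_def r_def l_def mult_ac)
  qed
  ultimately show thesis
    by (intro that[of \<mu> r l]) (unfold eigendecomposition_def, blast)
qed


subsection \<open>Minimisers\<close>

lemma finite_branches: "finite (branches mmax :: ('a::finite \<Rightarrow> int) set)"
proof -
  have "branches mmax = (UNIV \<rightarrow>\<^sub>E {- int mmax..int mmax} :: ('a \<Rightarrow> int) set)"
    by (auto simp: branches_def PiE_def)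
  then show ?thesis
    by (simp add: finite_PiE)
qed

lemma zero_in_branches: "(\<lambda>_. 0) \<in> branches mmax"
  by (simp add: branches_def)

text \<open>Each condition is a family of equations or weak inequalities between continuous
  functions of the entries. Closedness ensures that a nearest Lindbladian exists.\<close>

lemma closed_lindbladians: "closed (lindbladians :: 'n::finite supermat set)"
proof -
  have "closed {L :: 'n supermat. hermitian (Gamma_involution L)}"
    unfolding hermitian_def Gamma_involution_def
    by (simp, intro closed_Collect_all closed_Collect_eq continuous_intros)
  moreover have "closed {L :: 'n supermat. psd (omega_perp ** Gamma_involution L ** omega_perp)}"
    unfolding psd_def hermitian_def Gamma_involution_def braket_def matrix_matrix_mult_def
      matrix_vector_mult_def
    by (simp, intro closed_Collect_conj closed_Collect_all closed_Collect_eq closed_Collect_le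
        continuous_intros)
  moreover have "closed {L :: 'n supermat. bra omega v* L = 0}"
    unfolding vector_matrix_mult_def vec_eq_iff
    by (simp, intro closed_Collect_all closed_Collect_eq continuous_intros)
  ultimately show ?thesis
    by (auto simp: lindbladians_def intro!: closed_Collect_conj)
qed

lemma nearest_point_is_arg_min:
  fixes S :: "'a::heine_borel set"
  assumes "closed S" "S \<noteq> {}"
  shows "\<exists>x. is_arg_min (\<lambda>x. dist x a) (\<lambda>x. x \<in> S) x"
proof -
  obtain x where "x \<in> S" "\<forall>y\<in>S. dist a x \<le> dist a y"
    using distance_attains_inf[OF assms] by metis
  then show ?thesis
    by (auto simp: is_arg_min_def dist_commute not_less)
qed

text \<open>Every stage of the method can be carried out. Being an exponential, E has only nonzero
  eigenvalues, so principal logarithms exist; nearest points exist by closedness, and the branches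
  are finitely many.\<close>

lemma convex_solve_output_exists:
  fixes E :: "'n::finite supermat"
  assumes "diagonalisable E" "E = mexp A" "(lindbladians :: 'n supermat set) \<noteq> {}"
  shows "\<exists>L. convex_solve_output E mmax L"
proof -
  obtain \<mu> r l where E: "eigendecomposition E \<mu> r l"
    using eigendecomposition_exists[OF assms(1)] .
  have "r j \<noteq> 0" for j
  proof
    assume "r j = 0"
    moreover have "braket (l j) (r j) = 1"
      using eigendecomposition_biorthonormal[OF E, of j j] by simp
    ultimately show False
      by (simp add: braket_def)
  qed
  then have "\<mu> j \<noteq> 0" for j
    using mexp_eigenvalue_nonzero[of A "r j" "\<mu> j"] eigendecomposition_right_eigenvector[OF E]
      assms(2) by simp
  then have lam: "principal_log (\<mu> j) (Ln (\<mu> j))" for j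
    using mpi_less_Im_Ln[of "\<mu> j"] Im_Ln_le_pi[of "\<mu> j"] by (simp add: principal_log_def)
  have "\<exists>X. is_arg_min (\<lambda>X. norm (X - branch_log (\<lambda>j. Ln (\<mu> j)) r l m))
      (\<lambda>X. X \<in> lindbladians) X" for m
    using nearest_point_is_arg_min[OF closed_lindbladians assms(3)]
    by (simp only: dist_norm)
  then obtain Lm where Lm: "is_arg_min (\<lambda>X. norm (X - branch_log (\<lambda>j. Ln (\<mu> j)) r l m))
      (\<lambda>X. X \<in> lindbladians) (Lm m)" for m
    by metis
  have "\<exists>m. is_arg_min (\<lambda>m. norm (mexp (Lm m) - E)) (\<lambda>m. m \<in> branches mmax) m"
    by (rule ex_is_arg_min_if_finite[OF finite_branches]) (use zero_in_branches in blast)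
  then obtain mopt
    where mopt: "is_arg_min (\<lambda>m. norm (mexp (Lm m) - E)) (\<lambda>m. m \<in> branches mmax) mopt" ..
  have "convex_solve_output E mmax (Lm mopt)"
    unfolding convex_solve_output_def
    by (intro exI[of _ \<mu>] exI[of _ r] exI[of _ l] exI[of _ "\<lambda>j. Ln (\<mu> j)"] exI[of _ Lm]
        exI[of _ mopt] conjI ballI allI E lam Lm mopt refl)
  then show ?thesis ..
qed

text \<open>As the method is a relation, the claim has two halves: some output exists, and every
  output is correct whatever choices were made.\<close>

theorem theorem3p1:
  fixes Lideal Lstar Estar V :: "'n::finite supermat" and mmax :: nat
  assumes "Lideal \<in> lindbladians"
    and "diagonalises V Lideal"
    and "diagonalisable Estar"
    and "Lstar \<in> lindbladians"
    and "Estar = mexp Lstar"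
    and "norm (Lstar - Lideal) < (pi - spectral_radius Lideal) / condition_number V"
  shows "(\<exists>L. convex_solve_output Estar mmax L) \<and>
         (\<forall>L. convex_solve_output Estar mmax L \<longrightarrow> L \<in> lindbladians \<inter> mlog Estar)"
proof (intro conjI allI impI)
  show "\<exists>L. convex_solve_output Estar mmax L"
    using convex_solve_output_exists assms(3-5) by blast
next
  fix L assume "convex_solve_output Estar mmax L"
  then obtain \<mu> r l lam Lm mopt where E: "eigendecomposition Estar \<mu> r l"
    and lam: "\<And>j. principal_log (\<mu> j) (lam j)"
    and Lm: "\<And>m. m \<in> branches mmax \<Longrightarrow>
      is_arg_min (\<lambda>X. norm (X - branch_log lam r l m)) (\<lambda>X. X \<in> lindbladians) (Lm m)"
    and mopt: "is_arg_min (\<lambda>m. norm (mexp (Lm m) - Estar)) (\<lambda>m. m \<in> branches mmax) mopt"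
    and L: "L = Lm mopt"
    unfolding convex_solve_output_def by blast
  have small: "cmod a < pi" if "a \<in> eigenvalues Lstar" for a
    using eigenvalue_bound_near_diagonalisable[OF assms(2,6) that] .
  have "Lstar *v r j = lam j *s r j" for j
    using mexp_eigenvector_principal[OF small lam] eigendecomposition_right_eigenvector[OF E]
    unfolding assms(5) by blast
  then have "branch_log lam r l (\<lambda>_. 0) = Lstar"
    using branch_log_eq[OF E] by simp
  \<comment> \<open>\<open>Lstar\<close> is feasible and at distance 0 from the target of branch 0,
    so the minimiser there is at distance 0 too.\<close>
  then have "\<not> norm (Lstar - Lstar) < norm (Lm (\<lambda>_. 0) - Lstar)"
    using Lm[OF zero_in_branches] assms(4) unfolding is_arg_min_def by metis
  then have "Lm (\<lambda>_. 0) = Lstar"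
    by simp
  \<comment> \<open>The chosen branch need not be 0, but its error is at most that of branch 0,
    which vanishes.\<close>
  moreover have "\<not> norm (mexp (Lm (\<lambda>_. 0)) - Estar) < norm (mexp (Lm mopt) - Estar)"
    using mopt zero_in_branches unfolding is_arg_min_def by blast
  ultimately have "mexp L = Estar"
    using assms(5) L by simp
  moreover have "L \<in> lindbladians"
    using Lm[of mopt] mopt L by (auto simp: is_arg_min_def)
  ultimately show "L \<in> lindbladians \<inter> mlog Estar"
    by (simp add: mlog_def)
qed

end
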